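(* Let $A$ be a commutative ring with $1$, and for $i=1,\dots,t$ let $C_i$ be a cyclic code of length $n$ over $A$ with generator polynomial $g_i(x)$ and generating idempotent $e_i(x)$. Let $h_i(x)\in A[x]$ satisfy $h_i(x)g_i(x)=x^n-1$. Then, for each $i$, the dual code $C_i^{\perp}$ has generator polynomial the reciprocal polynomial $h_i^{*}(x)$ of $h_i(x)$, and generating idempotent $1-e_i(x^{-1})$.
   Context: A cyclic code of length $n$ over $A$ is an $A$-submodule of $A^n$ stable under $(c_0,\dots,c_{n-1})\mapsto(c_{n-1},c_0,\dots,c_{n-2})$; identifying $(c_0,\dots,c_{n-1})$ with $\sum c_ix^i$, cyclic codes are the ideals of $A[x]/(x^n-1)$. A generator polynomial of a cyclic code $C$ is a polynomial $g\in A[x]$ dividing $x^n-1$ in $A[x]$ with $C=\langle g\rangle$ in $A[x]/(x^n-1)$; a generating idempotent is an idempotent $e$ of $A[x]/(x^n-1)$ with $C=\langle e\rangle$. The dual code is $C^\perp=\{y\in A^n : \sum_j y_jc_j=0\ \forall c\in C\}$. For a polynomial $h$ of degree $d$, $h^{*}(x)=x^{d}h(x^{-1})$. In $A[x]/(x^n-1)$, $x^{-1}=x^{n-1}$, and $e(x^{-1})$ denotes the image of $e(x)$ under the substitution $x\mapsto x^{-1}$.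
   Formalization: That h_i* divides x^n−1 is claimed only when the leading coefficient of g_i is a unit, which is exactly when it holds (it fails for A=Z/4, n=1, g=1+2x, h=(1+2x)(x−1)); that h_i* generates the dual and the idempotent claim are unconditional. A is nonzero. *)

theory Defs
  imports "Jordan_Normal_Form.Matrix" "HOL-Computational_Algebra.Polynomial"
begin

definition cyclic_shift :: "'a vec \<Rightarrow> 'a vec" where
  "cyclic_shift c =
     vec (dim_vec c) (\<lambda>i. if i = 0 then c $ (dim_vec c - 1) else c $ (i - 1))"

definition cyclic_code :: "nat \<Rightarrow> 'a::comm_ring_1 vec set \<Rightarrow> bool" where
  "cyclic_code n C \<longleftrightarrow>
     C \<subseteq> carrier_vec n \<and> 0\<^sub>v n \<in> C \<and>
     (\<forall>c\<in>C. \<forall>d\<in>C. c + d \<in> C) \<and>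
     (\<forall>a. \<forall>c\<in>C. a \<cdot>\<^sub>v c \<in> C) \<and>
     (\<forall>c\<in>C. cyclic_shift c \<in> C)"

definition dual_code :: "nat \<Rightarrow> 'a::comm_ring_1 vec set \<Rightarrow> 'a vec set" where
  "dual_code n C = {y \<in> carrier_vec n. \<forall>c\<in>C. y \<bullet> c = 0}"

definition word_poly :: "'a::comm_ring_1 vec \<Rightarrow> 'a poly" where
  "word_poly c = (\<Sum>i<dim_vec c. monom (c $ i) i)"

(* Elements of A[x]/(x^n - 1) are given by arbitrary representatives in A[x];
   this relation is equality in the quotient ring. *)
definition cyc_cong :: "nat \<Rightarrow> 'a::comm_ring_1 poly \<Rightarrow> 'a poly \<Rightarrow> bool" where
  "cyc_cong n p q \<longleftrightarrow> (monom 1 n - 1) dvd (p - q)"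

(* The principal ideal generated by the class of f in A[x]/(x^n - 1), seen as a set of
   words via c |-> word_poly c, which for n > 0 is a bijection from A^n to the quotient. *)
definition cyc_ideal :: "nat \<Rightarrow> 'a::comm_ring_1 poly \<Rightarrow> 'a vec set" where
  "cyc_ideal n f = {c \<in> carrier_vec n. \<exists>q. cyc_cong n (word_poly c) (q * f)}"

definition generator_polynomial ::
    "nat \<Rightarrow> 'a::comm_ring_1 vec set \<Rightarrow> 'a poly \<Rightarrow> bool" where
  "generator_polynomial n C g \<longleftrightarrow> g dvd monom 1 n - 1 \<and> C = cyc_ideal n g"

definition generating_idempotent ::
    "nat \<Rightarrow> 'a::comm_ring_1 vec set \<Rightarrow> 'a poly \<Rightarrow> bool" where
  "generating_idempotent n C e \<longleftrightarrow> cyc_cong n (e * e) e \<and> C = cyc_ideal n e"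

(* A representative of p(x^(-1)), using x^(-1) = x^(n-1) in A[x]/(x^n - 1), for n > 0. *)
definition subst_inverse :: "nat \<Rightarrow> 'a::comm_ring_1 poly \<Rightarrow> 'a poly" where
  "subst_inverse n p = pcompose p (monom 1 (n - 1))"

(* The reciprocal polynomial x^d h(x^(-1)), d = degree h, is the library's reflect_poly h.

   A generator polynomial is not required to be monic. When A has zero divisors, its
   leading coefficient need not even be a unit, and then the reciprocal of the cofactor h
   still generates the dual code but never divides x^n - 1.
   Example: A = Z/4, n = 1, g = 1 + 2x, h = (1 + 2x)(x - 1), so that g h = x - 1; here
   reflect_poly h = 2 - x - x^2 vanishes at 2, whereas x - 1 does not. *)

end

theory Submission
  imports Defs
begin

text \<open>The dot product of two words \<open>y\<close>, \<open>c\<close> is the constant term of \<open>y(1/x) * c(x)\<close> in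
  \<open>R = A[x]/(x^n - 1)\<close>, and the constant-term pairing on \<open>R\<close> is nondegenerate. Hence the dual of
  \<open>\<langle>f\<rangle>\<close> is the image under \<open>x \<mapsto> 1/x\<close> of the annihilator of \<open>f\<close>. The annihilator of an
  idempotent \<open>e\<close> is \<open>\<langle>1 - e\<rangle>\<close>; that of \<open>g\<close> is \<open>\<langle>h\<rangle>\<close>, because \<open>g\<close> divides the monic polynomial
  \<open>x^n - 1\<close> and so is not a zero divisor in \<open>A[x]\<close>. Finally \<open>h(1/x)\<close> and the reciprocal of \<open>h\<close>
  differ by the unit \<open>x^deg h\<close> of \<open>R\<close>.\<close>

section \<open>Congruence modulo x^n - 1\<close>

lemma cyc_cong_refl [simp]: "cyc_cong n p p"
  by (simp add: cyc_cong_def)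

lemma cyc_cong_sym: "cyc_cong n p q \<Longrightarrow> cyc_cong n q p"
  unfolding cyc_cong_def by (metis dvd_minus_iff minus_diff_eq)

lemma cyc_cong_trans [trans]: "cyc_cong n p q \<Longrightarrow> cyc_cong n q r \<Longrightarrow> cyc_cong n p r"
  unfolding cyc_cong_def using dvd_add[of "monom 1 n - 1" "p - q" "q - r"] by simp

lemma cyc_cong_0_iff: "cyc_cong n p 0 \<longleftrightarrow> monom 1 n - 1 dvd p"
  by (simp add: cyc_cong_def)

lemma cyc_cong_add: "cyc_cong n p q \<Longrightarrow> cyc_cong n r s \<Longrightarrow> cyc_cong n (p + r) (q + s)"
  unfolding cyc_cong_def using dvd_add[of "monom 1 n - 1" "p - q" "r - s"] by (simp add: algebra_simps)

lemma cyc_cong_mult: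
  assumes "cyc_cong n p q" "cyc_cong n r s"
  shows "cyc_cong n (p * r) (q * s)"
proof -
  have "p * r - q * s = (p - q) * r + q * (r - s)" by (simp add: algebra_simps)
  with assms show ?thesis unfolding cyc_cong_def by (metis dvd_add dvd_mult dvd_mult2)
qed

lemma cyc_cong_sum:
  "(\<And>i. i \<in> I \<Longrightarrow> cyc_cong n (f i) (k i)) \<Longrightarrow> cyc_cong n (\<Sum>i\<in>I. f i) (\<Sum>i\<in>I. k i)"
  by (induction I rule: infinite_finite_induct) (auto intro: cyc_cong_add)

lemma cyc_cong_power: "cyc_cong n p q \<Longrightarrow> cyc_cong n (p ^ k) (q ^ k)"
  by (induction k) (auto intro: cyc_cong_mult)

text \<open>Exponents count only modulo \<open>n\<close> because x^n is 1 in the quotient; every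
  later manipulation of exponents comes down to this.\<close>

lemma cyc_cong_monom:
  fixes a :: "'a::comm_ring_1"
  assumes "i mod n = j mod n"
  shows "cyc_cong n (monom a i) (monom a j)"
proof -
  have *: "cyc_cong n (monom a k) (monom a (k mod n))" for k
  proof -
    have "cyc_cong n (monom 1 n) (1 :: 'a poly)"
      by (simp add: cyc_cong_def)
    then have "cyc_cong n (monom a (k mod n) * monom 1 n ^ (k div n))
        (monom a (k mod n) * 1 ^ (k div n))"
      by (intro cyc_cong_mult cyc_cong_power) simp_all
    moreover have "monom a (k mod n) * monom 1 n ^ (k div n) = monom a k"
      by (simp add: monom_power mult_monom)
    ultimately show ?thesis by simp
  qed
  show ?thesis using *[of i] *[of j] assms cyc_cong_sym cyc_cong_trans by metis
qed

section \<open>The substitution of 1/x for x\<close>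

lemma pcompose_monom_monom:
  fixes a :: "'a::comm_ring_1"
  shows "pcompose (monom a i) (monom 1 k) = monom a (i * k)"
  by (induction i) (simp_all add: monom_0 monom_Suc pcompose_pCons mult_monom add.commute)

lemma subst_inverse_1 [simp]: "subst_inverse n 1 = 1"
  and subst_inverse_diff: "subst_inverse n (p - q) = subst_inverse n p - subst_inverse n q"
  and subst_inverse_mult: "subst_inverse n (p * q) = subst_inverse n p * subst_inverse n q"
  and subst_inverse_sum: "subst_inverse n (\<Sum>i\<in>I. f i) = (\<Sum>i\<in>I. subst_inverse n (f i))"
  and subst_inverse_monom: "subst_inverse n (monom a i) = monom a (i * (n - 1))"
  by (simp_all add: subst_inverse_def pcompose_1 pcompose_diff pcompose_mult
      pcompose_sum pcompose_monom_monom)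

text \<open>The substitution descends to the quotient: it sends x^n - 1 to x^(n(n-1)) - 1, which is
  a multiple of x^n - 1.\<close>

lemma subst_inverse_cong:
  fixes p q :: "'a::comm_ring_1 poly"
  assumes "cyc_cong n p q"
  shows "cyc_cong n (subst_inverse n p) (subst_inverse n q)"
proof -
  obtain r where "p - q = (monom 1 n - 1) * r"
    using assms by (auto simp: cyc_cong_def)
  then have "subst_inverse n p - subst_inverse n q
      = (monom 1 (n * (n - 1)) - 1) * subst_inverse n r"
    by (metis subst_inverse_1 subst_inverse_diff subst_inverse_monom subst_inverse_mult)
  moreover have "monom 1 n - 1 dvd monom 1 (n * (n - 1)) - (1::'a poly)"
    using cyc_cong_monom[of "n * (n - 1)" n 0 "1::'a"] by (simp add: cyc_cong_def)
  ultimately show ?thesis by (simp add: cyc_cong_def)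
qed

lemma subst_inverse_involution:
  fixes p :: "'a::comm_ring_1 poly"
  assumes "n \<ge> 1"
  shows "cyc_cong n (subst_inverse n (subst_inverse n p)) p"
proof -
  \<comment> \<open>The square of n - 1 is 1 modulo \<open>n\<close>. Writing n = k + 2 exhibits it
    as 1 + k n without truncated subtraction; modulo 1 the claim is trivial.\<close>
  have "(i * (n - 1) * (n - 1)) mod n = i mod n" for i
  proof (cases "n = 1")
    case False
    then obtain k where n: "n = k + 2" 
      using assms le_Suc_ex[of 2 n] by (auto simp: add.commute)
    have "i * (n - 1) * (n - 1) = i + i * k * n" by (simp add: n algebra_simps)
    then show ?thesis by simp
  qed simp
  then have "cyc_cong n (subst_inverse n (subst_inverse n (\<Sum>i\<le>degree p. monom (coeff p i) i)))
      (\<Sum>i\<le>degree p. monom (coeff p i) i)"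
    unfolding subst_inverse_sum subst_inverse_monom by (intro cyc_cong_sum cyc_cong_monom)
  then show ?thesis by (simp add: poly_as_sum_of_monoms)
qed

section \<open>Reciprocal polynomials\<close>

lemma reflect_poly_as_sum:
  "reflect_poly (p :: 'a::comm_ring_1 poly) = (\<Sum>i\<le>degree p. monom (coeff p i) (degree p - i))"
proof (rule poly_eqI)
  fix k
  \<comment> \<open>For \<open>k > degree p\<close> the truncated difference
    \<open>degree p - k\<close> is 0, so the inner test is what removes a spurious term at
    \<open>i = 0\<close>.\<close>
  have "(\<Sum>i\<le>degree p. coeff (monom (coeff p i) (degree p - i)) k)
      = (\<Sum>i\<le>degree p. if i = degree p - k then (if k \<le> degree p then coeff p i else 0) else 0)"
    by (intro sum.cong) auto
  then show "coeff (reflect_poly p) k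
      = coeff (\<Sum>i\<le>degree p. monom (coeff p i) (degree p - i)) k"
    by (simp add: coeff_sum coeff_reflect_poly)
qed

text \<open>Modulo \<open>n\<close> the exponents d - i and d + i(n - 1) agree, so reversing the
  coefficients amounts to substituting 1/x and multiplying by x^d, where d is the degree.\<close>

lemma reflect_poly_cong:
  fixes p :: "'a::comm_ring_1 poly"
  assumes "n \<ge> 1"
  shows "cyc_cong n (reflect_poly p) (monom 1 (degree p) * subst_inverse n p)"
proof -
  have "(degree p - i) mod n = (degree p + i * (n - 1)) mod n" if "i \<le> degree p" for i
  proof -
    have "degree p + i * (n - 1) = (degree p - i) + i * n"
      using that assms by (cases n) auto
    then show ?thesis by simp
  qed
  then have "cyc_cong n (reflect_poly p) (\<Sum>i\<le>degree p. monom (coeff p i) (degree p + i * (n - 1)))"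
    unfolding reflect_poly_as_sum by (intro cyc_cong_sum cyc_cong_monom) auto
  also have "(\<Sum>i\<le>degree p. monom (coeff p i) (degree p + i * (n - 1)))
      = monom 1 (degree p) * subst_inverse n (\<Sum>i\<le>degree p. monom (coeff p i) i)"
    by (simp add: subst_inverse_sum subst_inverse_monom sum_distrib_left mult_monom)
  finally show ?thesis by (simp add: poly_as_sum_of_monoms)
qed

text \<open>The library's \<open>reflect_poly_mult\<close> assumes a ring without zero divisors; additivity of the
  degree is all that is needed.\<close>

lemma reflect_poly_mult_degree:
  fixes p q :: "'a::comm_ring_1 poly"
  assumes deg: "degree (p * q) = degree p + degree q"
  shows "reflect_poly (p * q) = reflect_poly p * reflect_poly q"
proof -
  define m where "m = degree p"
  define k where "k = degree q"
  \<comment> \<open>Reversal with respect to the fixed length m + k is additive, unlike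
    \<open>reflect_poly\<close>, whose length varies with the degree of its argument.\<close>
  define T where "T r = (\<Sum>i\<le>m + k. monom (coeff r i) (m + k - i))" for r :: "'a poly"
  have T_sum: "T (\<Sum>i\<in>I. f i) = (\<Sum>i\<in>I. T (f i))" for f :: "nat \<Rightarrow> 'a poly" and I
    unfolding T_def coeff_sum monom_sum by (rule sum.swap)
  have T_monom: "T (monom a i) = monom a (m + k - i)" if "i \<le> m + k" for a i
  proof -
    have "T (monom a i) = (\<Sum>j\<le>m + k. if j = i then monom a (m + k - i) else 0)"
      unfolding T_def by (intro sum.cong) auto
    then show ?thesis using that by simp
  qed
  have "p * q = (\<Sum>i\<le>m. monom (coeff p i) i) * (\<Sum>j\<le>k. monom (coeff q j) j)"
    by (simp add: m_def k_def poly_as_sum_of_monoms)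
  also have "\<dots> = (\<Sum>i\<le>m. \<Sum>j\<le>k. monom (coeff p i * coeff q j) (i + j))"
    by (simp add: sum_product mult_monom)
  finally have "T (p * q) = (\<Sum>i\<le>m. \<Sum>j\<le>k. monom (coeff p i * coeff q j) (m + k - (i + j)))"
    by (simp add: T_sum T_monom)
  also have "\<dots> = (\<Sum>i\<le>m. \<Sum>j\<le>k. monom (coeff p i) (m - i) * monom (coeff q j) (k - j))"
    by (intro sum.cong) (auto simp: mult_monom)
  also have "\<dots> = reflect_poly p * reflect_poly q"
    by (simp add: reflect_poly_as_sum sum_product m_def k_def)
  \<comment> \<open>Additivity of the degree makes m + k the actual degree of \<open>p * q\<close>,
    so that \<open>T\<close> reverses it exactly.\<close>
  finally show ?thesis
    by (simp add: T_def reflect_poly_as_sum[of "p * q"] deg m_def k_def)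
qed

section \<open>The constant-term functional\<close>

text \<open>The constant term of the representative of \<open>p\<close> of degree below \<open>n\<close> modulo \<open>x^n - 1\<close>.\<close>

definition const_term :: "nat \<Rightarrow> 'a::comm_ring_1 poly \<Rightarrow> 'a" where
  "const_term n p = (\<Sum>i\<le>degree p. if n dvd i then coeff p i else 0)"

lemma const_term_le:
  assumes "degree p \<le> N"
  shows "const_term n p = (\<Sum>i\<le>N. if n dvd i then coeff p i else 0)"
  unfolding const_term_def
  using assms by (intro sum.mono_neutral_left) (auto simp: coeff_eq_0)

lemma const_term_0 [simp]: "const_term n 0 = 0"
  by (simp add: const_term_def)

lemma const_term_add: "const_term n (p + q) = const_term n p + const_term n q"
proof -
  \<comment> \<open>The degree of the sum may drop, so all three constant terms are computed up to
    one common bound.\<close>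
  let ?N = "max (degree p) (degree q)"
  have "degree (p + q) \<le> ?N" by (rule degree_add_le_max)
  then show ?thesis
    by (simp add: const_term_le[where N = ?N] flip: sum.distrib) (auto intro!: sum.cong)
qed

lemma const_term_sum: "const_term n (\<Sum>i\<in>I. f i) = (\<Sum>i\<in>I. const_term n (f i))"
  by (induction I rule: infinite_finite_induct) (auto simp: const_term_add)

lemma const_term_diff: "const_term n (p - q) = const_term n p - const_term n q"
  using const_term_add[of n "p - q" q] by simp

lemma const_term_monom: "const_term n (monom a i) = (if n dvd i then a else 0)"
proof -
  have "const_term n (monom a i) = (\<Sum>j\<le>i. if j = i then (if n dvd i then a else 0) else 0)"
    unfolding const_term_le[OF degree_monom_le] by (intro sum.cong) auto
  then show ?thesis by simp
qed

text \<open>Multiplication by x^n - 1 turns x^i into x^(n+i) - x^i. Either both exponents are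
  divisible by \<open>n\<close> or neither is, so the contributions cancel.\<close>

lemma const_term_cong:
  fixes p q :: "'a::comm_ring_1 poly"
  assumes "cyc_cong n p q"
  shows "const_term n p = const_term n q"
proof -
  have *: "const_term n ((monom 1 n - 1) * r) = 0" for r :: "'a poly"
  proof -
    have "const_term n ((monom 1 n - 1) * (\<Sum>i\<le>degree r. monom (coeff r i) i)) = 0"
      by (simp add: sum_distrib_left const_term_sum left_diff_distrib const_term_diff
          mult_monom const_term_monom)
    then show ?thesis by (simp add: poly_as_sum_of_monoms)
  qed
  obtain r where "p - q = (monom 1 n - 1) * r"
    using assms by (auto simp: cyc_cong_def)
  with *[of r] have "const_term n (p - q) = 0" by simp
  then show ?thesis by (simp add: const_term_diff)
qed

section \<open>Words as representatives of the quotient ring\<close>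

lemma word_poly_add:
  "c \<in> carrier_vec n \<Longrightarrow> d \<in> carrier_vec n \<Longrightarrow> word_poly (c + d) = word_poly c + word_poly d"
  by (auto simp: word_poly_def add_monom simp flip: sum.distrib)

lemma word_poly_smult: "word_poly (a \<cdot>\<^sub>v c) = [:a:] * word_poly c"
  by (simp add: word_poly_def sum_distrib_left smult_monom)

lemma word_poly_zero [simp]: "word_poly (0\<^sub>v n) = 0"
  by (simp add: word_poly_def)

text \<open>Multiplication by x pushes the last coefficient to exponent \<open>n\<close>, which
  wraps around to exponent 0; all other terms agree literally.\<close>

lemma word_poly_cyclic_shift:
  assumes c: "c \<in> carrier_vec n" and "n \<ge> 1"
  shows "cyc_cong n (word_poly (cyclic_shift c)) (monom 1 1 * word_poly c)"
proof -
  obtain k where n: "n = Suc k" using assms by (cases n) auto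
  have dim: "dim_vec c = Suc k" using c n by simp
  have "word_poly (cyclic_shift c) = monom (c $ k) 0 + (\<Sum>i<k. monom (c $ i) (Suc i))"
    unfolding word_poly_def cyclic_shift_def dim
    by (simp only: dim_vec sum.lessThan_Suc_shift) simp
  moreover have "monom 1 1 * word_poly c = monom (c $ k) n + (\<Sum>i<k. monom (c $ i) (Suc i))"
    by (simp add: word_poly_def dim n sum_distrib_left mult_monom algebra_simps)
  moreover have "cyc_cong n (monom (c $ k) 0) (monom (c $ k) n)"
    by (rule cyc_cong_monom) simp
  ultimately show ?thesis by (simp add: cyc_cong_add)
qed

lemma ex_word_poly_cong:
  fixes p :: "'a::comm_ring_1 poly"
  assumes "n \<ge> 1"
  obtains c where "c \<in> carrier_vec n" "cyc_cong n (word_poly c) p"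
proof -
  have "\<exists>c\<in>carrier_vec n. cyc_cong n (word_poly c) (\<Sum>i<N. monom (coeff p i) i)" for N
  proof (induction N)
    case 0
    show ?case by (intro bexI[of _ "0\<^sub>v n"]) auto
  next
    case (Suc N)
    then obtain c where c: "c \<in> carrier_vec n"
      "cyc_cong n (word_poly c) (\<Sum>i<N. monom (coeff p i) i)" by blast
    \<comment> \<open>The term x^N folds onto position \<open>N mod n\<close>, a valid position
      since \<open>n\<close> is positive.\<close>
    define u where "u = vec n (\<lambda>i. if i = N mod n then coeff p N else 0)"
    have u: "u \<in> carrier_vec n" by (simp add: u_def)
    have "word_poly u = (\<Sum>i<n. if i = N mod n then monom (coeff p N) (N mod n) else 0)"
      unfolding word_poly_def u_def by (rule sum.cong) auto
    also have "\<dots> = monom (coeff p N) (N mod n)"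
      using assms by simp
    finally have "cyc_cong n (word_poly u) (monom (coeff p N) N)"
      by (simp add: cyc_cong_monom)
    with c u have "cyc_cong n (word_poly (c + u)) (\<Sum>i<Suc N. monom (coeff p i) i)"
      by (simp add: word_poly_add cyc_cong_add)
    with c u show ?case by (meson add_carrier_vec)
  qed
  from this[of "Suc (degree p)"] that show thesis
    by (auto simp: poly_as_sum_of_monoms lessThan_Suc_atMost simp del: sum.lessThan_Suc)
qed

section \<open>The dot product as a constant-term pairing\<close>

lemma dvd_mult_pred_add_iff:
  fixes i j n :: nat
  assumes "i < n" "j < n"
  shows "n dvd i * (n - 1) + j \<longleftrightarrow> i = j"
proof -
  \<comment> \<open>Modulo \<open>n\<close> the exponent is j - i. Over the integers this difference
    has absolute value below \<open>n\<close>, so divisibility forces it to be 0.\<close>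
  have "int (i * (n - 1) + j) = int i * int n + (int j - int i)"
    using assms by (cases n) (auto simp: algebra_simps)
  then have "n dvd i * (n - 1) + j \<longleftrightarrow> int n dvd int j - int i"
    by (metis dvd_add_right_iff dvd_triv_right of_nat_dvd_iff)
  also have "\<dots> \<longleftrightarrow> i = j"
    using assms zdvd_not_zless[of "int j - int i" "int n"] zdvd_not_zless[of "int i - int j" "int n"]
    by (auto simp: dvd_diff_commute) (metis linorder_neqE_nat)
  finally show ?thesis .
qed

text \<open>The factor x^(i(n-1)) acts as x^(-i) and moves coordinate \<open>i\<close> to the
  constant term.\<close>

lemma const_term_monom_word_poly:
  assumes "c \<in> carrier_vec n" "i < n"
  shows "const_term n (monom a (i * (n - 1)) * word_poly c) = a * c $ i"
proof -
  have "const_term n (monom a (i * (n - 1)) * word_poly c)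
      = (\<Sum>j<n. if j = i then a * c $ i else 0)"
    using assms
    by (auto simp: word_poly_def sum_distrib_left mult_monom const_term_sum const_term_monom
        dvd_mult_pred_add_iff simp del: One_nat_def intro!: sum.cong)
  then show ?thesis using assms by simp
qed

lemma scalar_prod_const_term:
  assumes "y \<in> carrier_vec n" "c \<in> carrier_vec n"
  shows "y \<bullet> c = const_term n (subst_inverse n (word_poly y) * word_poly c)"
  using assms
  by (simp add: word_poly_def[of y] subst_inverse_sum subst_inverse_monom sum_distrib_right
      const_term_sum const_term_monom_word_poly scalar_prod_def lessThan_atLeast0
      del: One_nat_def cong: sum.cong_simp)

lemma const_term_nondegenerate:
  fixes p :: "'a::comm_ring_1 poly"
  assumes "n \<ge> 1" and zero: "\<And>k. const_term n (monom 1 k * p) = 0"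
  shows "cyc_cong n p 0"
proof -
  obtain c where c: "c \<in> carrier_vec n" "cyc_cong n (word_poly c) p"
    using ex_word_poly_cong[OF assms(1)] by blast
  \<comment> \<open>Testing against \<open>k = i * (n - 1)\<close> reads off coordinate
    \<open>i\<close> of the word representing \<open>p\<close>.\<close>
  have "c $ i = 0" if "i < n" for i
    using const_term_monom_word_poly[OF c(1) that, of 1] zero[of "i * (n - 1)"]
      const_term_cong[OF cyc_cong_mult[OF cyc_cong_refl c(2)]] by simp
  with c(1) have "c = 0\<^sub>v n" by (intro eq_vecI) auto
  with c(2) show ?thesis by (simp add: cyc_cong_sym)
qed

section \<open>Principal ideals and their duals\<close>

lemma cyclic_code_cyc_ideal:
  fixes f :: "'a::comm_ring_1 poly"
  assumes "n \<ge> 1"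
  shows "cyclic_code n (cyc_ideal n f)"
  unfolding cyclic_code_def
proof (intro conjI ballI allI)
  show "cyc_ideal n f \<subseteq> carrier_vec n" by (auto simp: cyc_ideal_def)
  show "0\<^sub>v n \<in> cyc_ideal n f"
    by (auto simp: cyc_ideal_def intro!: exI[of _ 0])
next
  fix c assume "c \<in> cyc_ideal n f"
  then obtain q where c: "c \<in> carrier_vec n" and q: "cyc_cong n (word_poly c) (q * f)"
    by (auto simp: cyc_ideal_def)
  {
    fix d assume "d \<in> cyc_ideal n f"
    then obtain r where d: "d \<in> carrier_vec n" and r: "cyc_cong n (word_poly d) (r * f)"
      by (auto simp: cyc_ideal_def)
    have "cyc_cong n (word_poly (c + d)) ((q + r) * f)"
      using cyc_cong_add[OF q r] c d by (simp add: word_poly_add distrib_right)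
    with c d show "c + d \<in> cyc_ideal n f"
      unfolding cyc_ideal_def using add_carrier_vec by blast
  next
    fix a
    have "cyc_cong n (word_poly (a \<cdot>\<^sub>v c)) (([:a:] * q) * f)"
      unfolding word_poly_smult mult.assoc by (intro cyc_cong_mult cyc_cong_refl q)
    with c show "a \<cdot>\<^sub>v c \<in> cyc_ideal n f"
      unfolding cyc_ideal_def using smult_carrier_vec by blast
  next
    have "cyc_cong n (word_poly (cyclic_shift c)) (monom 1 1 * word_poly c)"
      using c assms by (rule word_poly_cyclic_shift)
    also have "cyc_cong n \<dots> ((monom 1 1 * q) * f)"
      unfolding mult.assoc by (intro cyc_cong_mult cyc_cong_refl q)
    finally show "cyclic_shift c \<in> cyc_ideal n f"
      using c unfolding cyc_ideal_def by (auto simp: cyclic_shift_def)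
  }
qed

lemma dual_cyc_ideal:
  fixes f :: "'a::comm_ring_1 poly"
  assumes n: "n \<ge> 1"
  shows "dual_code n (cyc_ideal n f)
    = {y \<in> carrier_vec n. cyc_cong n (subst_inverse n (word_poly y) * f) 0}"
  unfolding dual_code_def
proof (rule Collect_cong, rule conj_cong[OF refl], intro iffI ballI)
  fix y :: "'a vec"
  assume y: "y \<in> carrier_vec n" and orth: "\<forall>c\<in>cyc_ideal n f. y \<bullet> c = 0"
  show "cyc_cong n (subst_inverse n (word_poly y) * f) 0"
  proof (rule const_term_nondegenerate[OF n])
    fix k
    \<comment> \<open>The words of x^k f all lie in the code. Orthogonality to them, for every
      \<open>k\<close>, is what nondegeneracy of the pairing asks for.\<close>
    obtain c where c: "c \<in> carrier_vec n" "cyc_cong n (word_poly c) (monom 1 k * f)"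
      using ex_word_poly_cong[OF n] by blast
    then have "y \<bullet> c = 0"
      using orth by (auto simp: cyc_ideal_def)
    then show "const_term n (monom 1 k * (subst_inverse n (word_poly y) * f)) = 0"
      using scalar_prod_const_term[OF y c(1)] const_term_cong[OF cyc_cong_mult[OF cyc_cong_refl c(2)]]
      by (simp add: mult.left_commute)
  qed
next
  fix y c :: "'a vec"
  assume y: "y \<in> carrier_vec n" and ann: "cyc_cong n (subst_inverse n (word_poly y) * f) 0"
    and "c \<in> cyc_ideal n f"
  then obtain q where c: "c \<in> carrier_vec n" "cyc_cong n (word_poly c) (q * f)"
    by (auto simp: cyc_ideal_def)
  have "cyc_cong n (subst_inverse n (word_poly y) * word_poly c)
      (q * (subst_inverse n (word_poly y) * f))"
    by (subst mult.left_commute) (rule cyc_cong_mult[OF cyc_cong_refl c(2)])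
  also have "cyc_cong n \<dots> (q * 0)"
    by (intro cyc_cong_mult cyc_cong_refl ann)
  finally show "y \<bullet> c = 0"
    using const_term_cong scalar_prod_const_term[OF y c(1)] by fastforce
qed

text \<open>Substituting 1/x is an involutive automorphism of the quotient, so it exchanges the
  multiples of \<open>f\<close> with those of f(1/x).\<close>

lemma cyc_cong_subst_inverse_multiple_iff:
  fixes p f :: "'a::comm_ring_1 poly"
  assumes n: "n \<ge> 1"
  shows "(\<exists>q. cyc_cong n (subst_inverse n p) (q * f))
    \<longleftrightarrow> (\<exists>q. cyc_cong n p (q * subst_inverse n f))"
proof
  assume "\<exists>q. cyc_cong n (subst_inverse n p) (q * f)"
  then obtain q where "cyc_cong n (subst_inverse n p) (q * f)" ..
  from subst_inverse_cong[OF this]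
  have "cyc_cong n p (subst_inverse n q * subst_inverse n f)"
    using cyc_cong_trans cyc_cong_sym[OF subst_inverse_involution[OF n]]
    by (metis subst_inverse_mult)
  then show "\<exists>q. cyc_cong n p (q * subst_inverse n f)" ..
next
  assume "\<exists>q. cyc_cong n p (q * subst_inverse n f)"
  then obtain q where "cyc_cong n p (q * subst_inverse n f)" ..
  from subst_inverse_cong[OF this]
  have "cyc_cong n (subst_inverse n p) (subst_inverse n q * subst_inverse n (subst_inverse n f))"
    by (simp add: subst_inverse_mult)
  also have "cyc_cong n \<dots> (subst_inverse n q * f)"
    by (intro cyc_cong_mult cyc_cong_refl subst_inverse_involution[OF n])
  finally show "\<exists>q. cyc_cong n (subst_inverse n p) (q * f)" ..
qed

text \<open>Serves both halves of the theorem: it remains only to find a generator \<open>k\<close>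
  of the annihilator, once for a generator polynomial and once for an idempotent.\<close>

lemma dual_cyc_ideal_of_annihilator:
  fixes f k :: "'a::comm_ring_1 poly"
  assumes n: "n \<ge> 1"
    and ann: "\<And>p. cyc_cong n (p * f) 0 \<longleftrightarrow> (\<exists>q. cyc_cong n p (q * k))"
  shows "dual_code n (cyc_ideal n f) = cyc_ideal n (subst_inverse n k)"
  unfolding dual_cyc_ideal[OF n] ann cyc_cong_subst_inverse_multiple_iff[OF n]
  by (simp add: cyc_ideal_def)

text \<open>Associates generate the same ideal; \<open>v\<close> is the inverse of the unit
  \<open>u\<close> in the quotient.\<close>

lemma cyc_ideal_cong_unit:
  fixes f k u v :: "'a::comm_ring_1 poly"
  assumes f: "cyc_cong n f (u * k)" and uv: "cyc_cong n (v * u) 1"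
  shows "cyc_ideal n f = cyc_ideal n k"
proof -
  have "\<exists>r. cyc_cong n p (r * k)" if "cyc_cong n p (q * f)" for p q
  proof -
    have "cyc_cong n (q * f) (q * (u * k))" by (intro cyc_cong_mult cyc_cong_refl f)
    with that show ?thesis by (metis cyc_cong_trans mult.assoc)
  qed
  moreover have "\<exists>r. cyc_cong n p (r * f)" if "cyc_cong n p (q * k)" for p q
  proof -
    have "cyc_cong n (q * k * 1) (q * k * (v * u))"
      by (intro cyc_cong_mult cyc_cong_refl cyc_cong_sym[OF uv])
    also have "q * k * (v * u) = q * v * (u * k)" by (simp add: ac_simps)
    also have "cyc_cong n \<dots> (q * v * f)"
      by (intro cyc_cong_mult cyc_cong_refl cyc_cong_sym[OF f])
    finally show ?thesis using that by (metis cyc_cong_trans mult.right_neutral)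
  qed
  ultimately show ?thesis unfolding cyc_ideal_def by blast
qed

lemma cyc_ideal_reflect_poly:
  fixes p :: "'a::comm_ring_1 poly"
  assumes n: "n \<ge> 1"
  shows "cyc_ideal n (reflect_poly p) = cyc_ideal n (subst_inverse n p)"
proof (rule cyc_ideal_cong_unit[OF reflect_poly_cong[OF n]])
  \<comment> \<open>The inverse of x^d is x^(d(n-1)), since the exponents add up to a multiple of
    \<open>n\<close>.\<close>
  have "degree p * (n - 1) + degree p = degree p * n"
    using n by (cases n) auto
  then show "cyc_cong n (monom 1 (degree p * (n - 1)) * monom 1 (degree p)) (1 :: 'a poly)"
    using cyc_cong_monom[of "degree p * n" n 0 "1::'a"] by (simp add: mult_monom)
qed

section \<open>Annihilators of a generator polynomial and of an idempotent\<close>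

lemma lead_coeff_monom_diff_1:
  assumes "n \<ge> 1"
  shows "degree (monom 1 n - 1 :: 'a::comm_ring_1 poly) = n"
    and "lead_coeff (monom 1 n - 1 :: 'a poly) = 1"
proof -
  show deg: "degree (monom 1 n - 1 :: 'a poly) = n"
    using assms degree_add_eq_left[of "- 1" "monom 1 n :: 'a poly"]
    by (simp add: degree_monom_eq)
  show "lead_coeff (monom 1 n - 1 :: 'a poly) = 1"
    unfolding deg using assms by simp
qed

text \<open>The top coefficient of the product is that of \<open>p\<close>. This gives cancellation
  of x^n - 1 even when the coefficient ring has zero divisors.\<close>

lemma monic_mult_eq_0_iff:
  fixes m p :: "'a::comm_ring_1 poly"
  assumes "lead_coeff m = 1"
  shows "m * p = 0 \<longleftrightarrow> p = 0"
  using assms coeff_mult_degree_sum[of m p] by (auto simp: leading_coeff_0_iff)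

text \<open>If p g = h g q, multiplying by \<open>h\<close> produces the factor h g = x^n - 1, which
  can be cancelled and leaves p = q h. Conversely h g vanishes in the quotient.\<close>

lemma annihilator_of_cofactor:
  fixes g h p :: "'a::comm_ring_1 poly"
  assumes n: "n \<ge> 1" and hg: "h * g = monom 1 n - 1"
  shows "cyc_cong n (p * g) 0 \<longleftrightarrow> (\<exists>q. cyc_cong n p (q * h))"
proof
  assume "cyc_cong n (p * g) 0"
  then obtain q where "p * g = h * g * q"
    by (auto simp: cyc_cong_0_iff hg)
  moreover have "(monom 1 n - 1) * (p - q * h) = h * (p * g - h * g * q)"
    unfolding hg[symmetric] by (simp add: algebra_simps)
  ultimately have "(monom 1 n - 1) * (p - q * h) = 0" by simp
  then have "p - q * h = 0"
    using monic_mult_eq_0_iff[OF lead_coeff_monom_diff_1(2)[OF n]] by blast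
  then have "p = q * h" by simp
  then show "\<exists>q. cyc_cong n p (q * h)" using cyc_cong_refl by blast
next
  assume "\<exists>q. cyc_cong n p (q * h)"
  then obtain q where "cyc_cong n (p * g) (q * h * g)"
    using cyc_cong_mult cyc_cong_refl by blast
  also have "cyc_cong n \<dots> 0"
    by (simp add: cyc_cong_0_iff mult.assoc hg)
  finally show "cyc_cong n (p * g) 0" .
qed

text \<open>If p e vanishes then p = p (1 - e); conversely (1 - e) e = e - e^2 vanishes in the
  quotient.\<close>

lemma annihilator_of_idempotent:
  fixes e p :: "'a::comm_ring_1 poly"
  assumes e: "cyc_cong n (e * e) e"
  shows "cyc_cong n (p * e) 0 \<longleftrightarrow> (\<exists>q. cyc_cong n p (q * (1 - e)))"
proof
  assume "cyc_cong n (p * e) 0"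
  then have "cyc_cong n p (p * (1 - e))"
    by (simp add: cyc_cong_def algebra_simps)
  then show "\<exists>q. cyc_cong n p (q * (1 - e))" ..
next
  assume "\<exists>q. cyc_cong n p (q * (1 - e))"
  then obtain q where "cyc_cong n (p * e) (q * (1 - e) * e)"
    using cyc_cong_mult cyc_cong_refl by blast
  also have "q * (1 - e) * e = q * (e - e * e)"
    by (simp add: algebra_simps)
  also have "cyc_cong n \<dots> (q * 0)"
    using cyc_cong_sym[OF e] by (intro cyc_cong_mult cyc_cong_refl) (simp add: cyc_cong_def)
  finally show "cyc_cong n (p * e) 0" by simp
qed

section \<open>Generator polynomial and idempotent of the dual code\<close>

lemma reflect_poly_cofactor_dvd:
  fixes g h :: "'a::comm_ring_1 poly"
  assumes n: "n \<ge> 1" and hg: "h * g = monom 1 n - 1" and unit: "lead_coeff g dvd 1"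
  shows "reflect_poly h dvd monom 1 n - 1"
proof -
  have "h \<noteq> 0"
    using hg lead_coeff_monom_diff_1(2)[OF n, where 'a='a]
    by (metis coeff_0 mult_zero_left zero_neq_one)
  moreover obtain v where "1 = lead_coeff g * v" using unit ..
  \<comment> \<open>A unit cannot annihilate the nonzero leading coefficient of \<open>h\<close>.
    The top coefficient of the product therefore survives and degrees add, as factorwise reversal
    requires.\<close>
  ultimately have "lead_coeff h * lead_coeff g \<noteq> 0"
    by (metis leading_coeff_0_iff mult.assoc mult.right_neutral mult_zero_left)
  then have "degree (h * g) = degree h + degree g"
    by (metis coeff_mult_degree_sum degree_mult_le le_antisym le_degree)
  then have "reflect_poly h dvd reflect_poly (h * g)"
    by (simp add: reflect_poly_mult_degree)
  \<comment> \<open>Reversing x^n - 1 gives 1 - x^n, the same polynomial up to sign.\<close>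
  also have "reflect_poly (h * g) = - (monom 1 n - 1)"
    unfolding hg using n
    by (auto simp: poly_eq_iff coeff_reflect_poly lead_coeff_monom_diff_1(1))
  finally show ?thesis by (simp only: dvd_minus_iff)
qed

lemma idempotent_complement_subst_inverse:
  assumes "cyc_cong n (e * e) e"
  shows "cyc_cong n ((1 - subst_inverse n e) * (1 - subst_inverse n e)) (1 - subst_inverse n e)"
  using subst_inverse_cong[OF assms]
  by (simp add: cyc_cong_def subst_inverse_mult algebra_simps)

theorem theorem5:
  fixes C :: "nat \<Rightarrow> 'a::comm_ring_1 vec set"
    and g h e :: "nat \<Rightarrow> 'a poly"
    and n t :: nat
  assumes "n \<ge> 1"
    and "\<And>i. i \<in> {1..t} \<Longrightarrow> cyclic_code n (C i)"
    and "\<And>i. i \<in> {1..t} \<Longrightarrow> generator_polynomial n (C i) (g i)"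
    and "\<And>i. i \<in> {1..t} \<Longrightarrow> generating_idempotent n (C i) (e i)"
    and "\<And>i. i \<in> {1..t} \<Longrightarrow> h i * g i = monom 1 n - 1"
  shows "\<forall>i\<in>{1..t}.
           cyclic_code n (dual_code n (C i)) \<and>
           dual_code n (C i) = cyc_ideal n (reflect_poly (h i)) \<and>
           (lead_coeff (g i) dvd 1 \<longrightarrow>
              generator_polynomial n (dual_code n (C i)) (reflect_poly (h i))) \<and>
           generating_idempotent n (dual_code n (C i)) (1 - subst_inverse n (e i))"
proof (intro ballI)
  fix i assume i: "i \<in> {1..t}"
  note n = \<open>n \<ge> 1\<close>
  \<comment> \<open>The code is presented both by \<open>g i\<close> and by \<open>e i\<close>;
    dualising each presentation separately yields the reciprocal and the idempotent.\<close>
  have g: "C i = cyc_ideal n (g i)"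
    using assms(3)[OF i] by (simp add: generator_polynomial_def)
  have e: "C i = cyc_ideal n (e i)" and idem: "cyc_cong n (e i * e i) (e i)"
    using assms(4)[OF i] by (simp_all add: generating_idempotent_def)
  have dual_h: "dual_code n (C i) = cyc_ideal n (reflect_poly (h i))"
    unfolding g cyc_ideal_reflect_poly[OF n]
    by (intro dual_cyc_ideal_of_annihilator annihilator_of_cofactor n assms(5) i)
  have "dual_code n (C i) = cyc_ideal n (subst_inverse n (1 - e i))"
    unfolding e by (intro dual_cyc_ideal_of_annihilator annihilator_of_idempotent n idem)
  then have dual_e: "dual_code n (C i) = cyc_ideal n (1 - subst_inverse n (e i))"
    by (simp add: subst_inverse_diff)
  show "cyclic_code n (dual_code n (C i)) \<and>
           dual_code n (C i) = cyc_ideal n (reflect_poly (h i)) \<and>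
           (lead_coeff (g i) dvd 1 \<longrightarrow>
              generator_polynomial n (dual_code n (C i)) (reflect_poly (h i))) \<and>
           generating_idempotent n (dual_code n (C i)) (1 - subst_inverse n (e i))"
    using cyclic_code_cyc_ideal[OF n] dual_h dual_e idempotent_complement_subst_inverse[OF idem]
      reflect_poly_cofactor_dvd[OF n assms(5)[OF i]]
    by (simp add: generator_polynomial_def generating_idempotent_def)
qed

end
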